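(* Let $d\ge 1$, let $v=(0,\ldots,0,1)\in\mathbb{R}^{d+1}$ and let $s\in\mathbb{R}_{>0}$. For arbitrary center $c\in\mathbb{R}^d$ and radius $r\in\mathbb{R}_{>0}$, the image under $S(\cdot,v,s)$ of the hyperball $B(c,r)$ is a hyperspherical cap $C(p,b)$ on $\mathcal{S}_d$. The direction $p$ and bias $b$ of the hyperspherical cap are $$p=\left(\beta c,\ \sqrt{1-\beta^2\|c\|^2}\right),\qquad b=\frac{s\sqrt{s^2+\beta^2\|c\|^2r^2}-r^2\sqrt{1-\beta^2\|c\|^2}}{r^2+s^2},$$ where $$\beta:=\frac{2s}{\sqrt{(\|c\|^2+r^2+s^2)^2-4\|c\|^2r^2}}.$$
   Context: $\mathcal{S}_d=\{x\in\mathbb{R}^{d+1}:\|x\|=1\}$ is the unit sphere in $\mathbb{R}^{d+1}$, $\|\cdot\|$ is the Euclidean norm, and $\langle\cdot,\cdot\rangle$ is the standard inner product. For $v=(0,\ldots,0,1)\in\mathbb{R}^{d+1}$ and $s>0$, the spherical embedding is $$S(x,v,s)=2s\,\frac{[x,s]}{\|x\|^2+s^2}-v\in\mathcal{S}_d,\qquad x\in\mathbb{R}^d,$$ where $[x,s]\in\mathbb{R}^{d+1}$ is $x$ extended by the last coordinate $s$. The (open) hyperball with center $c\in\mathbb{R}^d$ and radius $r>0$ is $B(c,r)=\{x\in\mathbb{R}^d:\|x-c\|<r\}$. The (open) hyperspherical cap with unit direction $p\in\mathcal{S}_d$ and bias $b\in(-1,1)$ is $C(p,b)=\{x\in\mathcal{S}_d:\langle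 x,p\rangle>b\}$.
   Formalization: In both p and b, the root √(1−β²‖c‖²) is taken with a minus sign when ‖c‖² > r²+s²; the printed nonnegative root is false there (e.g. s = r = 1, ‖c‖ = 10, where S(c,v,s) lies outside the stated cap). *)

theory Defs
  imports "HOL-Analysis.Analysis"
begin

(* R^(d+1) is represented by the product type (real^'n) * real with d = CARD('n):
   [x,s] is the pair (x, s), and the library's norm and inner product on pairs are
   the Euclidean ones.  The unit sphere S_d is sphere 0 1 in this type, and the open
   hyperball B(c,r) is the library's ball c r. *)

definition spherical_embedding ::
    "real^'n \<Rightarrow> (real^'n) \<times> real \<Rightarrow> real \<Rightarrow> (real^'n) \<times> real" where
  "spherical_embedding x v s = (2 * s / ((norm x)\<^sup>2 + s\<^sup>2)) *\<^sub>R (x, s) - v"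

definition spherical_cap ::
    "(real^'n) \<times> real \<Rightarrow> real \<Rightarrow> ((real^'n) \<times> real) set" where
  "spherical_cap p b = {x \<in> sphere 0 1. x \<bullet> p > b}"

(* The last coordinate of the cap direction is the root of 1 - beta^2 |c|^2 that has
   the sign of r^2 + s^2 - |c|^2 (the root is 0 when this difference is 0): the cap
   direction points into the lower hemisphere exactly when |c|^2 > r^2 + s^2.  With the
   nonnegative root in that case, the image of the ball would not be the stated cap. *)
definition root_sign :: "real^'n \<Rightarrow> real \<Rightarrow> real \<Rightarrow> real" where
  "root_sign c r s = (if (norm c)\<^sup>2 \<le> r\<^sup>2 + s\<^sup>2 then 1 else - 1)"

end

theory Submission
  imports Defs
begin

text \<open>
  Put \<open>K = \<parallel>c\<parallel>\<^sup>2\<close> and let \<open>D\<close> be the radicand in \<open>\<beta>\<close>. Since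
  \<open>D = (r\<^sup>2 + s\<^sup>2 - K)\<^sup>2 + 4 s\<^sup>2 K = (K + s\<^sup>2 - r\<^sup>2)\<^sup>2 + 4 s\<^sup>2 r\<^sup>2\<close>, both nested roots are rational in
  \<open>\<surd>D\<close>: the direction is \<open>(2 s c, r\<^sup>2 + s\<^sup>2 - K) / \<surd>D\<close> and the bias is \<open>(K + s\<^sup>2 - r\<^sup>2) / \<surd>D\<close>.
  With these closed forms the cap inequality at an embedded point, cleared of denominators, is
  \<open>\<parallel>x - c\<parallel>\<^sup>2 < r\<^sup>2\<close>. The embedding is onto the sphere without \<open>-v\<close>, and \<open>-v\<close> is
  never in the cap.
\<close>

lemma spherical_embedding_north:
  "spherical_embedding x (0, 1) s =
     ((2 * s / ((norm x)\<^sup>2 + s\<^sup>2)) *\<^sub>R x, 2 * s\<^sup>2 / ((norm x)\<^sup>2 + s\<^sup>2) - 1)"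
  by (simp add: spherical_embedding_def power2_eq_square)

lemma spherical_embedding_in_sphere:
  assumes "s > 0"
  shows "spherical_embedding x (0, 1) s \<in> sphere 0 1"
proof -
  define X where "X = (norm x)\<^sup>2"
  have "X + s\<^sup>2 > 0"
    using assms by (simp add: X_def add_nonneg_pos)
  then have "(2 * s / (X + s\<^sup>2))\<^sup>2 * X + (2 * s\<^sup>2 / (X + s\<^sup>2) - 1)\<^sup>2 = 1"
    by (simp add: divide_simps) algebra
  then show ?thesis
    by (simp add: spherical_embedding_north norm_prod_def power_mult_distrib power_divide X_def)
qed

text \<open>Adding \<open>v\<close> to an embedded point gives a multiple of \<open>(x, s)\<close>,
  so \<open>(u, 1 + t)\<close> must be parallel to \<open>(x, s)\<close>; the last coordinates then
  force the preimage.\<close>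

lemma spherical_embedding_surj:
  assumes "s > 0" "(u, t) \<in> sphere 0 1" "t \<noteq> - 1"
  shows "spherical_embedding ((s / (1 + t)) *\<^sub>R u) (0, 1) s = (u, t)"
proof -
  have U: "(norm u)\<^sup>2 = (1 - t) * (1 + t)"
    using assms(2) by (simp add: norm_prod_def algebra_simps power2_eq_square)
  have t: "1 + t \<noteq> 0"
    using assms(3) by linarith
  have N: "(norm ((s / (1 + t)) *\<^sub>R u))\<^sup>2 + s\<^sup>2 = 2 * s\<^sup>2 / (1 + t)"
    unfolding norm_scaleR power_mult_distrib real_norm_def power2_abs U power_divide
    using t by (simp add: divide_simps) algebra
  show ?thesis
    unfolding spherical_embedding_north N
    using t assms(1) by (simp add: power2_eq_square)
qed

text \<open>The root of the square is an absolute value, and \<open>root_sign\<close> restores the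
  lost sign.\<close>

lemma root_sign_sqrt_square:
  "root_sign c r s * sqrt ((r\<^sup>2 + s\<^sup>2 - (norm c)\<^sup>2)\<^sup>2) = r\<^sup>2 + s\<^sup>2 - (norm c)\<^sup>2"
  by (simp add: root_sign_def)

text \<open>Direction and bias share the factor \<open>1 / Q\<close>, so any positive
  \<open>Q\<close> gives the same half-space.\<close>

lemma embedding_in_cap_iff:
  fixes x c :: "real^'n"
  assumes "s > 0" "r > 0" "Q > 0"
  shows "spherical_embedding x (0, 1) s \<bullet>
           ((2 * s / Q) *\<^sub>R c, (r\<^sup>2 + s\<^sup>2 - (norm c)\<^sup>2) / Q)
           > ((norm c)\<^sup>2 + s\<^sup>2 - r\<^sup>2) / Q \<longleftrightarrow> x \<in> ball c r"
proof -
  define X K i where "X = (norm x)\<^sup>2" and "K = (norm c)\<^sup>2" and "i = x \<bullet> c"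
  define N where "N = X + s\<^sup>2"
  have N: "N > 0"
    using assms by (simp add: N_def X_def add_nonneg_pos)
  define L where "L = (2 * s / N) * ((2 * s / Q) * i) + (2 * s\<^sup>2 / N - 1) * ((r\<^sup>2 + s\<^sup>2 - K) / Q)"
  have d: "(norm (x - c))\<^sup>2 = X - 2 * i + K"
    by (simp add: X_def K_def i_def power2_norm_eq_inner inner_diff inner_commute)
  \<comment> \<open>Over the denominator \<open>N * Q\<close>, the terms with factor
    \<open>N\<close> combine to \<open>- 2 * s\<^sup>2 * N\<close>, because \<open>K\<close> and
    \<open>r\<^sup>2\<close> cancel; hence the common factor \<open>2 * s\<^sup>2\<close>.\<close>
  have "L - (K + s\<^sup>2 - r\<^sup>2) / Q = 2 * s\<^sup>2 / (N * Q) * (r\<^sup>2 - (X - 2 * i + K))"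
    using N assms(3) unfolding L_def
    by (simp add: divide_simps) (simp add: N_def, algebra)
  moreover have "2 * s\<^sup>2 / (N * Q) > 0"
    using N assms by simp
  ultimately have "L > (K + s\<^sup>2 - r\<^sup>2) / Q \<longleftrightarrow> (norm (x - c))\<^sup>2 < r\<^sup>2"
    unfolding d by (smt (verit) zero_less_mult_pos mult_pos_pos)
  also have "\<dots> \<longleftrightarrow> x \<in> ball c r"
    using assms(2) abs_le_square_iff[of r "norm (x - c)"]
    by (simp add: dist_norm norm_minus_commute[of c x] flip: not_le)
  finally show ?thesis
    by (simp add: spherical_embedding_north L_def N_def X_def K_def i_def mult.commute)
qed

lemma image_ball_eq_cap:
  fixes c :: "real^'n"
  assumes "s > 0" "r > 0" "Q > 0"
  shows "(\<lambda>x. spherical_embedding x (0, 1) s) ` ball c r =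
    spherical_cap ((2 * s / Q) *\<^sub>R c, (r\<^sup>2 + s\<^sup>2 - (norm c)\<^sup>2) / Q) (((norm c)\<^sup>2 + s\<^sup>2 - r\<^sup>2) / Q)"
    (is "?S ` _ = spherical_cap ?p ?b")
proof (intro subset_antisym subsetI)
  fix y assume "y \<in> ?S ` ball c r"
  then obtain x where "x \<in> ball c r" "y = ?S x"
    by blast
  then show "y \<in> spherical_cap ?p ?b"
    unfolding spherical_cap_def
    using embedding_in_cap_iff[OF assms] spherical_embedding_in_sphere[OF assms(1)] by blast
next
  fix y assume y: "y \<in> spherical_cap ?p ?b"
  obtain u t where ut: "y = (u, t)"
    by fastforce
  have sph: "(u, t) \<in> sphere 0 1" and gt: "y \<bullet> ?p > ?b"
    using y ut by (auto simp: spherical_cap_def)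
  \<comment> \<open>Only the pole \<open>- v\<close> has no preimage. There the cap inequality would
    reduce to \<open>- s\<^sup>2 > s\<^sup>2\<close>.\<close>
  have "t \<noteq> - 1"
  proof
    assume t: "t = - 1"
    then have "u = 0"
      using sph by (simp add: norm_prod_def)
    then have "?b < ((norm c)\<^sup>2 - (r\<^sup>2 + s\<^sup>2)) / Q"
      using gt ut t by simp
    then have "(norm c)\<^sup>2 + s\<^sup>2 - r\<^sup>2 < (norm c)\<^sup>2 - (r\<^sup>2 + s\<^sup>2)"
      using assms(3) by (simp add: divide_less_cancel)
    then show False
      by simp
  qed
  then have "y = ?S ((s / (1 + t)) *\<^sub>R u)"
    using spherical_embedding_surj[OF assms(1) sph] ut by simp
  then show "y \<in> ?S ` ball c r"
    using gt embedding_in_cap_iff[OF assms] by blast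
qed

theorem theorem2:
  fixes v p :: "(real^'n) \<times> real" and c :: "real^'n" and s r \<beta> b :: real
  assumes "v = (0, 1)" and "s > 0" and "r > 0"
    and "\<beta> = 2 * s / sqrt (((norm c)\<^sup>2 + r\<^sup>2 + s\<^sup>2)\<^sup>2 - 4 * (norm c)\<^sup>2 * r\<^sup>2)"
    and "p = (\<beta> *\<^sub>R c, root_sign c r s * sqrt (1 - \<beta>\<^sup>2 * (norm c)\<^sup>2))"
    and "b = (s * sqrt (s\<^sup>2 + \<beta>\<^sup>2 * (norm c)\<^sup>2 * r\<^sup>2)
              - r\<^sup>2 * (root_sign c r s * sqrt (1 - \<beta>\<^sup>2 * (norm c)\<^sup>2))) / (r\<^sup>2 + s\<^sup>2)"
  shows "p \<in> sphere 0 1 \<and> b \<in> {- 1 <..< 1} \<and>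
         (\<lambda>x. spherical_embedding x v s) ` ball c r = spherical_cap p b"
proof -
  define K where "K = (norm c)\<^sup>2"
  define D where "D = (K + r\<^sup>2 + s\<^sup>2)\<^sup>2 - 4 * K * r\<^sup>2"
  define Q where "Q = sqrt D"
  have K: "K \<ge> 0"
    by (simp add: K_def)
  \<comment> \<open>\<open>D1\<close> evaluates the root in \<open>p\<close> and normalizes
    \<open>p\<close>; \<open>D2\<close> gives \<open>D > 0\<close> and bounds the bias.\<close>
  have D1: "D = (r\<^sup>2 + s\<^sup>2 - K)\<^sup>2 + 4 * s\<^sup>2 * K"
    and D2: "D = (K + s\<^sup>2 - r\<^sup>2)\<^sup>2 + 4 * s\<^sup>2 * r\<^sup>2"
    unfolding D_def by algebra+
  have gap: "4 * s\<^sup>2 * r\<^sup>2 > 0"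
    using assms(2,3) by simp
  then have D: "D > 0"
    unfolding D2 by (simp add: add_nonneg_pos)
  then have Q: "Q > 0" and Q2: "Q\<^sup>2 = D"
    by (simp_all add: Q_def)
  have \<beta>: "\<beta> = 2 * s / Q"
    using assms(4) by (simp add: Q_def D_def K_def)
  then have \<beta>2: "\<beta>\<^sup>2 = 4 * s\<^sup>2 / D"
    by (simp add: power_divide power_mult_distrib Q2)
  have "1 - \<beta>\<^sup>2 * K = (r\<^sup>2 + s\<^sup>2 - K)\<^sup>2 / D"
    using D unfolding \<beta>2 by (simp add: field_simps) (simp add: D1 algebra_simps)
  then have q: "root_sign c r s * sqrt (1 - \<beta>\<^sup>2 * K) = (r\<^sup>2 + s\<^sup>2 - K) / Q"
    using root_sign_sqrt_square[of c r s]
    by (simp add: real_sqrt_divide K_def Q_def del: real_sqrt_abs)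
  \<comment> \<open>The numerator is \<open>s\<^sup>2 * (D + 4 * K * r\<^sup>2)\<close>, a perfect
    square by the definition of \<open>D\<close>.\<close>
  have "s\<^sup>2 + \<beta>\<^sup>2 * K * r\<^sup>2 = (s * (K + r\<^sup>2 + s\<^sup>2))\<^sup>2 / D"
    using D unfolding \<beta>2 by (simp add: field_simps) (unfold D_def, algebra)
  moreover have "s * (K + r\<^sup>2 + s\<^sup>2) \<ge> 0"
    using K assms(2) by simp
  ultimately have "sqrt (s\<^sup>2 + \<beta>\<^sup>2 * K * r\<^sup>2) = s * (K + r\<^sup>2 + s\<^sup>2) / Q"
    by (simp add: real_sqrt_divide Q_def)
  then have "b = (s * (s * (K + r\<^sup>2 + s\<^sup>2) / Q) - r\<^sup>2 * ((r\<^sup>2 + s\<^sup>2 - K) / Q)) / (r\<^sup>2 + s\<^sup>2)"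
    using assms(6) q by (simp add: K_def)
  \<comment> \<open>The terms in \<open>s\<^sup>2 * r\<^sup>2\<close> cancel, and
    \<open>s^4 - r^4\<close> splits off the factor \<open>r\<^sup>2 + s\<^sup>2\<close>.\<close>
  also have "\<dots> = (r\<^sup>2 + s\<^sup>2) * (K + s\<^sup>2 - r\<^sup>2) / Q / (r\<^sup>2 + s\<^sup>2)"
    by (simp add: diff_divide_distrib[symmetric] algebra_simps power2_eq_square)
  also have "\<dots> = (K + s\<^sup>2 - r\<^sup>2) / Q"
    using assms(2) by simp
  finally have b: "b = (K + s\<^sup>2 - r\<^sup>2) / Q" .
  have p: "p = ((2 * s / Q) *\<^sub>R c, (r\<^sup>2 + s\<^sup>2 - K) / Q)"
    using assms(5) q \<beta> by (simp add: K_def)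
  have "(2 * s / Q)\<^sup>2 * K + ((r\<^sup>2 + s\<^sup>2 - K) / Q)\<^sup>2 = 1"
    unfolding power_divide Q2 using D by (simp add: field_simps) (simp add: D1 algebra_simps)
  then have "p \<in> sphere 0 1"
    unfolding p by (simp add: norm_prod_def power_mult_distrib power_divide K_def)
  \<comment> \<open>By \<open>D2\<close> the numerator of \<open>b\<^sup>2\<close> is
    \<open>D - 4 * s\<^sup>2 * r\<^sup>2\<close>, strictly below \<open>D\<close>.\<close>
  moreover have "b\<^sup>2 < 1"
    unfolding b power_divide Q2 using D gap D2 by simp
  then have "b \<in> {- 1 <..< 1}"
    by (simp add: abs_square_less_1 abs_less_iff)
  moreover have "(\<lambda>x. spherical_embedding x v s) ` ball c r = spherical_cap p b"
    using image_ball_eq_cap[OF assms(2,3) Q] unfolding assms(1) p b K_def .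
  ultimately show ?thesis
    by blast
qed

end
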